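(* Let $L>0$, $\rho\ge0$, let $F:\mathbb{R}^d\to\mathbb{R}^d$ be $L$-Lipschitz and $\rho$-star-negative comonotone with $\rho<\frac{1}{2L}$, and let $x^*$ satisfy $F(x^* )=0$. Then, for any $2\rho<\gamma_1<\frac1L$ and $0<\gamma_2<\min\{\frac1L-\gamma_1,\gamma_1-2\rho\}$, the iterates produced by the Optimistic Gradient method with stepsizes $\gamma_1,\gamma_2$ from any $x^0\in\mathbb{R}^d$ satisfy, for all $N\ge0$, $$\frac{1}{N+1}\sum_{k=0}^N\|F(\widetilde x^k)\|^2\le\frac{\|x^0-x^*\|^2}{\gamma_1\gamma_2(1-L^2(\gamma_1+\gamma_2)^2)(N+1)}.$$ If, in addition, $F$ is $\rho$-negative comonotone with $\rho\le\frac{5}{62L}$ and $\gamma_1=\gamma_2=\gamma$ (in place of the conditions $2\rho<\gamma_1<\frac1L$ and $0<\gamma_2<\min\{\frac1L-\gamma_1,\gamma_1-2\rho\}$ on the stepsizes) with $\gamma>0$ and $4\rho\le\gamma\le\frac{10}{31L}$, then for any $N\ge1$ the iterates produced by the Optimistic Gradient method satisfy $$\|F(x^N)\|^2\le\frac{717\|x^0-x^*\|^2}{N\gamma(\gamma-3\rho)+800\gamma^2}.$$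
   Context: For a single-valued operator $F:\mathbb{R}^d\to\mathbb{R}^d$ and $\rho\ge0$: $F$ is $L$-Lipschitz if $\|F(x)-F(y)\|\le L\|x-y\|$ for all $x,y$; $F$ is $\rho$-negative comonotone if $\langle F(x)-F(y),x-y\rangle\ge-\rho\|F(x)-F(y)\|^2$ for all $x,y$; $F$ is $\rho$-star-negative comonotone if $\langle F(x),x-x^*\rangle\ge-\rho\|F(x)\|^2$ for all $x$ and $x^*$ a solution, where a solution is a point $x^*$ with $F(x^* )=0$ (assumed to exist). The Optimistic Gradient method with stepsizes $\gamma_1,\gamma_2$ generates from $x^0$, with $\widetilde x^0=x^0$: $\widetilde x^k=x^k-\gamma_1F(\widetilde x^{k-1})$ for all $k>0$, and $x^{k+1}=x^k-\gamma_2F(\widetilde x^k)$ for all $k\ge0$. *)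

theory Defs
  imports "HOL-Analysis.Analysis"
begin

definition negative_comonotone :: "real \<Rightarrow> ('a::real_inner \<Rightarrow> 'a) \<Rightarrow> bool" where
  "negative_comonotone \<rho> F \<longleftrightarrow>
     (\<forall>x y. (F x - F y) \<bullet> (x - y) \<ge> - \<rho> * (norm (F x - F y))\<^sup>2)"

text \<open>The inequality is required at every solution. That a solution exists is not part of the
  definition, so it has to be assumed separately.\<close>

definition star_negative_comonotone :: "real \<Rightarrow> ('a::real_inner \<Rightarrow> 'a) \<Rightarrow> bool" where
  "star_negative_comonotone \<rho> F \<longleftrightarrow>
     (\<forall>x xs. F xs = 0 \<longrightarrow> F x \<bullet> (x - xs) \<ge> - \<rho> * (norm (F x))\<^sup>2)"

text \<open>\<open>x\<close> and \<open>xt\<close> are the sequences $x^k$ and $\widetilde x^k$. The equations determine both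
  sequences uniquely from \<open>x0\<close>; existence is shown below.\<close>

definition optimistic_gradient ::
  "('a::real_vector \<Rightarrow> 'a) \<Rightarrow> real \<Rightarrow> real \<Rightarrow> 'a \<Rightarrow> (nat \<Rightarrow> 'a) \<Rightarrow> (nat \<Rightarrow> 'a) \<Rightarrow> bool" where
  "optimistic_gradient F \<gamma>\<^sub>1 \<gamma>\<^sub>2 x0 x xt \<longleftrightarrow>
     x 0 = x0 \<and> xt 0 = x0 \<and>
     (\<forall>k>0. xt k = x k - \<gamma>\<^sub>1 *\<^sub>R F (xt (k - 1))) \<and>
     (\<forall>k. x (Suc k) = x k - \<gamma>\<^sub>2 *\<^sub>R F (xt k))"

lemma optimistic_gradient_exists: "\<exists>x xt. optimistic_gradient F \<gamma>\<^sub>1 \<gamma>\<^sub>2 x0 x xt"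
proof -
  define s where "s = rec_nat (x0, x0) (\<lambda>_ (a, b).
    let a' = a - \<gamma>\<^sub>2 *\<^sub>R F b in (a', a' - \<gamma>\<^sub>1 *\<^sub>R F b))"
  have "optimistic_gradient F \<gamma>\<^sub>1 \<gamma>\<^sub>2 x0 (fst \<circ> s) (snd \<circ> s)"
    unfolding optimistic_gradient_def
  proof (intro conjI allI impI)
    fix k :: nat assume "k > 0"
    then show "(snd \<circ> s) k = (fst \<circ> s) k - \<gamma>\<^sub>1 *\<^sub>R F ((snd \<circ> s) (k - 1))"
      by (cases k) (simp_all add: s_def Let_def split: prod.splits)
  qed (simp_all add: s_def Let_def split: prod.splits)
  then show ?thesis by blast
qed

end

theory Submission
  imports Defs
begin

text \<open>
  Both bounds come from quantities that decrease along the run. Write $h_k = F(\widetilde x^k)$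
  and let $p_k = h_{k-1}$, with $p_0 = 0$. Since $\widetilde x^0 = x^0$, this convention gives
  $\widetilde x^k = x^k - \gamma_1 p_k$ for every $k$ including $0$, so that the first step is not
  special. The error of the method is the drift $h_k - p_k$: with equal stepsizes, if the drift
  vanished then $x^{k+1} = \widetilde x^k$ and the method would be the implicit (proximal point)
  iteration.

  Average of the squared norms. Expanding the square of $x^{k+1} - x^*$ and using star-negative
  comonotonicity, each step changes the squared distance by at most
  $\gamma_1\gamma_2(\|h_k - p_k\|^2 - \|p_k\|^2)$. By Lipschitz continuity the drift
  obeys a linear recursion, and because $L(\gamma_1+\gamma_2) < 1$ a multiple of the
  drift can be added to the distance to absorb the positive term. The resulting
  potential loses at least $\gamma_1\gamma_2(1 - L^2(\gamma_1+\gamma_2)^2)\|h_k\|^2$ per step, and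
  telescoping gives the bound (lemmas \<open>averaged_potential_step\<close>, \<open>averaged_potential_nonneg\<close>
  and \<open>averaged_potential_start\<close>).

  Last iterate. With equal stepsizes the residual
  $V_k = \|F(x^k)\|^2 + \|F(x^k) - p_k\|^2$ is nonincreasing, and it even drops by at least
  $\|h_k - p_k\|^2/50$ (lemma \<open>residual_decrease\<close>). Therefore $V_k$ may be multiplied by a weight
  growing linearly in $k$: the growth costs $\gamma(\gamma - 3\rho) V_{k+1}$ per step, that is at
  most a multiple of $\|h_k\|^2$, which the decrease of the squared distance pays for, and a
  multiple of the drift. This drift, and the one in the estimate of the distance, is paid for by the drop of $V_k$, multiplied by the
  constant part $800\gamma^2$ of the weight (lemma \<open>last_iterate_potential_step\<close>).
\<close>

section \<open>Runs of the optimistic gradient method\<close>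

locale optimistic_gradient_run =
  fixes F :: "'a::real_inner \<Rightarrow> 'a" and L \<rho> \<gamma>\<^sub>1 \<gamma>\<^sub>2 :: real
    and x0 xstar :: 'a and x xt :: "nat \<Rightarrow> 'a"
  assumes run: "optimistic_gradient F \<gamma>\<^sub>1 \<gamma>\<^sub>2 x0 x xt"
    and lipschitz: "L-lipschitz_on UNIV F"
    and star: "star_negative_comonotone \<rho> F"
    and solution: "F xstar = 0"
    and L_pos: "L > 0" and \<rho>_nonneg: "\<rho> \<ge> 0"
    and \<gamma>\<^sub>1_pos: "\<gamma>\<^sub>1 > 0" and \<gamma>\<^sub>2_pos: "\<gamma>\<^sub>2 > 0"
begin

abbreviation h :: "nat \<Rightarrow> 'a" where
  "h k \<equiv> F (xt k)"

text \<open>The value $0$ at index $0$ is what makes \<open>xt_eq\<close> hold at the start of the run.\<close>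

definition p :: "nat \<Rightarrow> 'a" where
  "p k = (case k of 0 \<Rightarrow> 0 | Suc j \<Rightarrow> h j)"

lemma p_0 [simp]: "p 0 = 0" and p_Suc [simp]: "p (Suc k) = h k"
  by (simp_all add: p_def)

lemma x_0: "x 0 = x0" and xt_0: "xt 0 = x0"
  using run by (simp_all add: optimistic_gradient_def)

lemma x_Suc: "x (Suc k) = x k - \<gamma>\<^sub>2 *\<^sub>R h k"
  using run by (simp add: optimistic_gradient_def)

lemma xt_eq: "xt k = x k - \<gamma>\<^sub>1 *\<^sub>R p k"
  using run by (cases k) (simp_all add: optimistic_gradient_def)

lemma lipschitz_sq: "(norm (F a - F b))\<^sup>2 \<le> L\<^sup>2 * (norm (a - b))\<^sup>2"
proof -
  have "norm (F a - F b) \<le> L * norm (a - b)"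
    using lipschitz_onD[OF lipschitz, of a b] by (simp add: dist_norm)
  then have "(norm (F a - F b))\<^sup>2 \<le> (L * norm (a - b))\<^sup>2"
    by (rule power_mono) simp
  then show ?thesis
    by (simp add: power_mult_distrib)
qed

lemma start_residual: "(norm (F x0))\<^sup>2 \<le> L\<^sup>2 * (norm (x0 - xstar))\<^sup>2"
  using lipschitz_sq[of x0 xstar] by (simp add: solution)

lemma distance_step:
  "(norm (x (Suc k) - xstar))\<^sup>2
     \<le> (norm (x k - xstar))\<^sup>2 + (2 * \<rho> * \<gamma>\<^sub>2 + \<gamma>\<^sub>2\<^sup>2) * (norm (h k))\<^sup>2 - 2 * \<gamma>\<^sub>1 * \<gamma>\<^sub>2 * (h k \<bullet> p k)"
proof -
  have "- \<rho> * (norm (h k))\<^sup>2 \<le> h k \<bullet> (xt k - xstar)"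
    using star solution by (simp add: star_negative_comonotone_def)
  also have "\<dots> = h k \<bullet> (x k - xstar) - \<gamma>\<^sub>1 * (h k \<bullet> p k)"
    by (simp add: xt_eq inner_diff_right)
  finally have "0 \<le> 2 * \<gamma>\<^sub>2 * (h k \<bullet> (x k - xstar) - \<gamma>\<^sub>1 * (h k \<bullet> p k) + \<rho> * (norm (h k))\<^sup>2)"
    using \<gamma>\<^sub>2_pos by (intro mult_nonneg_nonneg) auto
  moreover have "x (Suc k) - xstar = (x k - xstar) - \<gamma>\<^sub>2 *\<^sub>R h k"
    by (simp add: x_Suc)
  then have "(norm (x (Suc k) - xstar))\<^sup>2
      = (norm (x k - xstar))\<^sup>2 - 2 * \<gamma>\<^sub>2 * (h k \<bullet> (x k - xstar)) + \<gamma>\<^sub>2\<^sup>2 * (norm (h k))\<^sup>2"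
    unfolding power2_norm_eq_inner
    by (simp only: inner_diff_left inner_diff_right inner_scaleR_left inner_scaleR_right)
      (simp add: inner_commute algebra_simps power2_eq_square)
  ultimately show ?thesis
    by (simp add: algebra_simps)
qed

section \<open>The averaged bound\<close>

abbreviation drift :: "nat \<Rightarrow> real" where
  "drift k \<equiv> (norm (h k - p k))\<^sup>2"

text \<open>The displacement of $\widetilde x$ is a combination of $h_k$ and $h_k - p_k$ with weights
  $\gamma_2$ and $\gamma_1$; convexity of the squared norm separates the two.\<close>

lemma drift_step:
  "drift (Suc k) \<le> L\<^sup>2 * (\<gamma>\<^sub>1 + \<gamma>\<^sub>2) * (\<gamma>\<^sub>2 * (norm (h k))\<^sup>2 + \<gamma>\<^sub>1 * drift k)"
proof -
  define a b where "a = h k" and "b = h k - p k"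
  have "xt (Suc k) - xt k = - (\<gamma>\<^sub>2 *\<^sub>R a + \<gamma>\<^sub>1 *\<^sub>R b)"
    by (simp add: xt_eq x_Suc a_def b_def algebra_simps)
  then have "drift (Suc k) \<le> L\<^sup>2 * (norm (\<gamma>\<^sub>2 *\<^sub>R a + \<gamma>\<^sub>1 *\<^sub>R b))\<^sup>2"
    using lipschitz_sq[of "xt (Suc k)" "xt k"] by (metis norm_minus_cancel p_Suc)
  moreover have "(norm (\<gamma>\<^sub>2 *\<^sub>R a + \<gamma>\<^sub>1 *\<^sub>R b))\<^sup>2
      = (\<gamma>\<^sub>1 + \<gamma>\<^sub>2) * (\<gamma>\<^sub>2 * (norm a)\<^sup>2 + \<gamma>\<^sub>1 * (norm b)\<^sup>2) - \<gamma>\<^sub>1 * \<gamma>\<^sub>2 * (norm (a - b))\<^sup>2"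
    unfolding power2_norm_eq_inner
    by (simp add: inner_add_left inner_add_right inner_diff_left inner_diff_right
        inner_commute algebra_simps)
  then have "(norm (\<gamma>\<^sub>2 *\<^sub>R a + \<gamma>\<^sub>1 *\<^sub>R b))\<^sup>2
      \<le> (\<gamma>\<^sub>1 + \<gamma>\<^sub>2) * (\<gamma>\<^sub>2 * (norm a)\<^sup>2 + \<gamma>\<^sub>1 * (norm b)\<^sup>2)"
    using \<gamma>\<^sub>1_pos \<gamma>\<^sub>2_pos by simp
  then have "L\<^sup>2 * (norm (\<gamma>\<^sub>2 *\<^sub>R a + \<gamma>\<^sub>1 *\<^sub>R b))\<^sup>2
      \<le> L\<^sup>2 * ((\<gamma>\<^sub>1 + \<gamma>\<^sub>2) * (\<gamma>\<^sub>2 * (norm a)\<^sup>2 + \<gamma>\<^sub>1 * (norm b)\<^sup>2))"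
    by (rule mult_left_mono) simp
  ultimately show ?thesis
    by (simp add: a_def b_def mult.assoc)
qed

lemma distance_step_drift:
  assumes "\<gamma>\<^sub>2 \<le> \<gamma>\<^sub>1 - 2 * \<rho>"
  shows "(norm (x (Suc k) - xstar))\<^sup>2
    \<le> (norm (x k - xstar))\<^sup>2 - \<gamma>\<^sub>1 * \<gamma>\<^sub>2 * (norm (p k))\<^sup>2 + \<gamma>\<^sub>1 * \<gamma>\<^sub>2 * drift k"
proof -
  have "0 \<le> \<gamma>\<^sub>2 * (\<gamma>\<^sub>1 - 2 * \<rho> - \<gamma>\<^sub>2) * (norm (h k))\<^sup>2"
    using assms \<gamma>\<^sub>2_pos by simp
  moreover have "2 * (h k \<bullet> p k) = (norm (h k))\<^sup>2 + (norm (p k))\<^sup>2 - drift k"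
    unfolding power2_norm_eq_inner
    by (simp add: inner_diff_left inner_diff_right inner_commute)
  then have "2 * \<gamma>\<^sub>1 * \<gamma>\<^sub>2 * (h k \<bullet> p k)
      = \<gamma>\<^sub>1 * \<gamma>\<^sub>2 * ((norm (h k))\<^sup>2 + (norm (p k))\<^sup>2 - drift k)"
    by (metis (no_types, opaque_lifting) mult.assoc mult.commute)
  ultimately show ?thesis
    using distance_step[of k] by (simp add: algebra_simps power2_eq_square)
qed

text \<open>The coefficient $c = 1 - L^2(\gamma_1+\gamma_2)\gamma_1$ is the one for which the drift
  terms cancel exactly in \<open>averaged_potential_step\<close>: the distance contributes
  $c\,\gamma_1\gamma_2$ times the drift, and the recursion of the drift contributes
  $(1 - c)\,\gamma_1\gamma_2$ times it. The negative term shifts the gain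
  $\|p_k\|^2 = \|h_{k-1}\|^2$ of the distance by one index.\<close>

definition averaged_potential :: "nat \<Rightarrow> real" where
  "averaged_potential k =
     (1 - L\<^sup>2 * (\<gamma>\<^sub>1 + \<gamma>\<^sub>2) * \<gamma>\<^sub>1) * ((norm (x k - xstar))\<^sup>2 - \<gamma>\<^sub>1 * \<gamma>\<^sub>2 * (norm (p k))\<^sup>2)
       + \<gamma>\<^sub>1 * \<gamma>\<^sub>2 * drift k"

context
  assumes steps: "\<gamma>\<^sub>2 \<le> \<gamma>\<^sub>1 - 2 * \<rho>" "L * (\<gamma>\<^sub>1 + \<gamma>\<^sub>2) < 1"
begin

lemma contraction: "L\<^sup>2 * (\<gamma>\<^sub>1 + \<gamma>\<^sub>2)\<^sup>2 < 1"
proof -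
  have "0 \<le> L * (\<gamma>\<^sub>1 + \<gamma>\<^sub>2)"
    using L_pos \<gamma>\<^sub>1_pos \<gamma>\<^sub>2_pos by simp
  then have "(L * (\<gamma>\<^sub>1 + \<gamma>\<^sub>2))\<^sup>2 < 1"
    using steps(2) by (simp add: power_less_one_iff)
  then show ?thesis
    by (simp add: power_mult_distrib)
qed

lemma drift_weight_bounds:
  "0 \<le> 1 - L\<^sup>2 * (\<gamma>\<^sub>1 + \<gamma>\<^sub>2) * \<gamma>\<^sub>1" "1 - L\<^sup>2 * (\<gamma>\<^sub>1 + \<gamma>\<^sub>2) * \<gamma>\<^sub>1 \<le> 1"
proof -
  have "L\<^sup>2 * (\<gamma>\<^sub>1 + \<gamma>\<^sub>2) * \<gamma>\<^sub>1 \<le> L\<^sup>2 * (\<gamma>\<^sub>1 + \<gamma>\<^sub>2) * (\<gamma>\<^sub>1 + \<gamma>\<^sub>2)"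
    using \<gamma>\<^sub>1_pos \<gamma>\<^sub>2_pos by (intro mult_left_mono) auto
  also have "\<dots> < 1"
    using contraction by (simp add: power2_eq_square mult.assoc)
  finally show "0 \<le> 1 - L\<^sup>2 * (\<gamma>\<^sub>1 + \<gamma>\<^sub>2) * \<gamma>\<^sub>1"
    by simp
  show "1 - L\<^sup>2 * (\<gamma>\<^sub>1 + \<gamma>\<^sub>2) * \<gamma>\<^sub>1 \<le> 1"
    using \<gamma>\<^sub>1_pos \<gamma>\<^sub>2_pos by simp
qed

lemma averaged_potential_step:
  "averaged_potential (Suc k)
     \<le> averaged_potential k - \<gamma>\<^sub>1 * \<gamma>\<^sub>2 * (1 - L\<^sup>2 * (\<gamma>\<^sub>1 + \<gamma>\<^sub>2)\<^sup>2) * (norm (h k))\<^sup>2"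
proof -
  define c where "c = 1 - L\<^sup>2 * (\<gamma>\<^sub>1 + \<gamma>\<^sub>2) * \<gamma>\<^sub>1"
  have "c * (norm (x (Suc k) - xstar))\<^sup>2
      \<le> c * ((norm (x k - xstar))\<^sup>2 - \<gamma>\<^sub>1 * \<gamma>\<^sub>2 * (norm (p k))\<^sup>2 + \<gamma>\<^sub>1 * \<gamma>\<^sub>2 * drift k)"
    using distance_step_drift[OF steps(1)] drift_weight_bounds(1)
    unfolding c_def by (rule mult_left_mono)
  moreover have "\<gamma>\<^sub>1 * \<gamma>\<^sub>2 * drift (Suc k)
      \<le> \<gamma>\<^sub>1 * \<gamma>\<^sub>2 * (L\<^sup>2 * (\<gamma>\<^sub>1 + \<gamma>\<^sub>2) * (\<gamma>\<^sub>2 * (norm (h k))\<^sup>2 + \<gamma>\<^sub>1 * drift k))"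
    using drift_step \<gamma>\<^sub>1_pos \<gamma>\<^sub>2_pos by (intro mult_left_mono) auto
  moreover have "\<gamma>\<^sub>1 * \<gamma>\<^sub>2 * (L\<^sup>2 * (\<gamma>\<^sub>1 + \<gamma>\<^sub>2) * (\<gamma>\<^sub>2 * (norm (h k))\<^sup>2 + \<gamma>\<^sub>1 * drift k))
      = \<gamma>\<^sub>1 * \<gamma>\<^sub>2 * (1 - c) * drift k
        + \<gamma>\<^sub>1 * \<gamma>\<^sub>2 * (c - (1 - L\<^sup>2 * (\<gamma>\<^sub>1 + \<gamma>\<^sub>2)\<^sup>2)) * (norm (h k))\<^sup>2"
    by (simp add: c_def algebra_simps power2_eq_square)
  ultimately show ?thesis
    unfolding averaged_potential_def c_def[symmetric] p_Suc by (simp add: algebra_simps)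
qed

text \<open>Despite its negative term the potential dominates the multiple
  $1 - L^2(\gamma_1+\gamma_2)\gamma_1$ of the next squared distance.\<close>

lemma averaged_potential_nonneg: "0 \<le> averaged_potential k"
proof -
  define c where "c = 1 - L\<^sup>2 * (\<gamma>\<^sub>1 + \<gamma>\<^sub>2) * \<gamma>\<^sub>1"
  have c: "0 \<le> c" "c \<le> 1"
    using drift_weight_bounds by (simp_all add: c_def)
  have "0 \<le> c * (norm (x (Suc k) - xstar))\<^sup>2"
    using c by simp
  also have "\<dots> \<le> c * ((norm (x k - xstar))\<^sup>2 - \<gamma>\<^sub>1 * \<gamma>\<^sub>2 * (norm (p k))\<^sup>2 + \<gamma>\<^sub>1 * \<gamma>\<^sub>2 * drift k)"
    using distance_step_drift[OF steps(1)] c(1) by (rule mult_left_mono)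
  also have "\<dots> = c * ((norm (x k - xstar))\<^sup>2 - \<gamma>\<^sub>1 * \<gamma>\<^sub>2 * (norm (p k))\<^sup>2)
      + c * (\<gamma>\<^sub>1 * \<gamma>\<^sub>2 * drift k)"
    by (simp add: algebra_simps)
  also have "\<dots> \<le> averaged_potential k"
    unfolding averaged_potential_def c_def[symmetric]
    using c \<gamma>\<^sub>1_pos \<gamma>\<^sub>2_pos by (intro add_left_mono mult_left_le_one_le) auto
  finally show ?thesis .
qed

lemma averaged_potential_start: "averaged_potential 0 \<le> (norm (x0 - xstar))\<^sup>2"
proof -
  have "\<gamma>\<^sub>1 * \<gamma>\<^sub>2 * (norm (F x0))\<^sup>2 \<le> \<gamma>\<^sub>1 * \<gamma>\<^sub>2 * (L\<^sup>2 * (norm (x0 - xstar))\<^sup>2)"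
    using start_residual \<gamma>\<^sub>1_pos \<gamma>\<^sub>2_pos by (intro mult_left_mono) auto
  moreover have "0 \<le> \<gamma>\<^sub>1\<^sup>2 * (L\<^sup>2 * (norm (x0 - xstar))\<^sup>2)"
    by simp
  ultimately show ?thesis
    by (simp add: averaged_potential_def x_0 xt_0 algebra_simps power2_eq_square)
qed

lemma sum_gradient_bound:
  "\<gamma>\<^sub>1 * \<gamma>\<^sub>2 * (1 - L\<^sup>2 * (\<gamma>\<^sub>1 + \<gamma>\<^sub>2)\<^sup>2) * (\<Sum>k<n. (norm (h k))\<^sup>2) \<le> (norm (x0 - xstar))\<^sup>2"
proof -
  have "\<gamma>\<^sub>1 * \<gamma>\<^sub>2 * (1 - L\<^sup>2 * (\<gamma>\<^sub>1 + \<gamma>\<^sub>2)\<^sup>2) * (\<Sum>k<n. (norm (h k))\<^sup>2)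
      \<le> averaged_potential 0 - averaged_potential n"
  proof (induction n)
    case 0
    show ?case by simp
  next
    case (Suc n)
    then show ?case
      using averaged_potential_step[of n] by (simp add: distrib_left)
  qed
  then show ?thesis
    using averaged_potential_nonneg[of n] averaged_potential_start by linarith
qed

lemma averaged_bound:
  "1 / (real N + 1) * (\<Sum>k=0..N. (norm (h k))\<^sup>2)
     \<le> (norm (x0 - xstar))\<^sup>2 / (\<gamma>\<^sub>1 * \<gamma>\<^sub>2 * (1 - L\<^sup>2 * (\<gamma>\<^sub>1 + \<gamma>\<^sub>2)\<^sup>2) * (real N + 1))"
proof -
  define D where "D = \<gamma>\<^sub>1 * \<gamma>\<^sub>2 * (1 - L\<^sup>2 * (\<gamma>\<^sub>1 + \<gamma>\<^sub>2)\<^sup>2)"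
  have "D > 0"
    using contraction \<gamma>\<^sub>1_pos \<gamma>\<^sub>2_pos by (simp add: D_def)
  have "{0..N} = {..<Suc N}"
    by auto
  then have "D * (\<Sum>k=0..N. (norm (h k))\<^sup>2) \<le> (norm (x0 - xstar))\<^sup>2"
    using sum_gradient_bound[of "Suc N"] by (simp only: D_def)
  then have "(\<Sum>k=0..N. (norm (h k))\<^sup>2) \<le> (norm (x0 - xstar))\<^sup>2 / D"
    using \<open>D > 0\<close> by (simp add: pos_le_divide_eq mult.commute)
  then have "(\<Sum>k=0..N. (norm (h k))\<^sup>2) / (real N + 1)
      \<le> (norm (x0 - xstar))\<^sup>2 / D / (real N + 1)"
    by (intro divide_right_mono) auto
  then show ?thesis
    unfolding D_def[symmetric] by (simp add: mult.commute)
qed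

end

end

section \<open>The last-iterate bound\<close>

text \<open>The right-hand side is the maximum of the left-hand side over $w$. This eliminates
  $w = F(x^k) - h_k$, which, unlike $u = F(x^{k+1}) - h_k$, is not controlled by the drift
  $v = h_k - p_k$.\<close>

lemma residual_form_le:
  fixes u v w :: "'a::real_inner"
  shows "(norm (u - w))\<^sup>2 / 2 + 2 * (norm u)\<^sup>2 - (norm w)\<^sup>2 - (norm (w + v))\<^sup>2
    \<le> 8/3 * (norm u)\<^sup>2 + 2/3 * (u \<bullet> v) - 1/3 * (norm v)\<^sup>2"
proof -
  have "8/3 * (norm u)\<^sup>2 + 2/3 * (u \<bullet> v) - 1/3 * (norm v)\<^sup>2
      - ((norm (u - w))\<^sup>2 / 2 + 2 * (norm u)\<^sup>2 - (norm w)\<^sup>2 - (norm (w + v))\<^sup>2)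
      = 3/2 * (norm (w + (1/3) *\<^sub>R u + (2/3) *\<^sub>R v))\<^sup>2"
    unfolding power2_norm_eq_inner
    by (simp add: inner_add_left inner_add_right inner_diff_left inner_diff_right
        inner_commute field_simps)
  moreover have "0 \<le> 3/2 * (norm (w + (1/3) *\<^sub>R u + (2/3) *\<^sub>R v))\<^sup>2"
    by simp
  ultimately show ?thesis
    by linarith
qed

locale equal_step_run = optimistic_gradient_run F L \<rho> \<gamma> \<gamma> x0 xstar x xt
  for F :: "'a::real_inner \<Rightarrow> 'a" and L \<rho> \<gamma> x0 xstar x xt +
  assumes comonotone: "negative_comonotone \<rho> F"
    and step_lower: "4 * \<rho> \<le> \<gamma>" and step_upper: "L * \<gamma> \<le> 10/31"
begin

lemma L\<gamma>_sq_le: "(L * \<gamma>)\<^sup>2 \<le> 100/961"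
proof -
  have "(L * \<gamma>)\<^sup>2 \<le> (10/31)\<^sup>2"
    using step_upper L_pos \<gamma>\<^sub>1_pos by (intro power_mono) auto
  then show ?thesis
    by (simp add: power2_eq_square)
qed

text \<open>The shape in which comonotonicity enters: points differ by a multiple of the
  stepsize, and $\rho \le \gamma/4$ makes the constant independent of $\rho$.\<close>

lemma comonotone_scaled:
  assumes "a - b = \<gamma> *\<^sub>R d"
  shows "- (norm (F a - F b))\<^sup>2 / 4 \<le> (F a - F b) \<bullet> d"
proof -
  have "- (\<gamma> / 4) * (norm (F a - F b))\<^sup>2 \<le> - \<rho> * (norm (F a - F b))\<^sup>2"
    using step_lower by (intro mult_right_mono) auto
  also have "\<dots> \<le> (F a - F b) \<bullet> (a - b)"
    using comonotone by (simp add: negative_comonotone_def)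
  finally have "\<gamma> * (- (norm (F a - F b))\<^sup>2 / 4) \<le> \<gamma> * ((F a - F b) \<bullet> d)"
    by (simp add: assms)
  then show ?thesis
    using \<gamma>\<^sub>1_pos by (simp only: mult_le_cancel_left_pos)
qed

text \<open>Comonotonicity along a step yields the gain $\|F(x^k) - h_k\|^2$ by itself. With the gain
  $\|F(x^k) - p_k\|^2$ from the second summand the total is at least half the drift, and a
  multiple of the drift is needed to outweigh the error of replacing $F(x^{k+1})$ by $h_k$.\<close>

definition residual :: "nat \<Rightarrow> real" where
  "residual k = (norm (F (x k)))\<^sup>2 + (norm (F (x k) - p k))\<^sup>2"

lemma x_Suc_minus_xt: "x (Suc k) - xt k = \<gamma> *\<^sub>R (p k - h k)"
  by (simp add: x_Suc xt_eq algebra_simps)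

lemma gradient_error: "(norm (F (x (Suc k)) - h k))\<^sup>2 \<le> 100/961 * drift k"
proof -
  have "(norm (F (x (Suc k)) - h k))\<^sup>2 \<le> L\<^sup>2 * (norm (\<gamma> *\<^sub>R (p k - h k)))\<^sup>2"
    using lipschitz_sq[of "x (Suc k)" "xt k"] by (simp only: x_Suc_minus_xt)
  also have "\<dots> = (L * \<gamma>)\<^sup>2 * drift k"
    by (simp add: power_mult_distrib norm_minus_commute)
  also have "\<dots> \<le> 100/961 * drift k"
    using L\<gamma>_sq_le by (rule mult_right_mono) simp
  finally show ?thesis .
qed

text \<open>Comonotonicity is used along the actual step, from $x^k$ to $x^{k+1}$, and also between
  $x^{k+1}$ and $\widetilde x^k$. The latter controls the cross term left over by
  \<open>residual_form_le\<close>; together with the Lipschitz bound it leaves the factor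
  $\frac{17}{6}\cdot\frac{100}{961} - \frac13 < -\frac1{50}$ in front of the drift.\<close>

lemma residual_decrease: "residual (Suc k) \<le> residual k - drift k / 50"
proof -
  define u v w where "u = F (x (Suc k)) - h k" and "v = h k - p k" and "w = F (x k) - h k"
  have uw: "F (x (Suc k)) - F (x k) = u - w"
    by (simp add: u_def w_def)
  have "- (norm (u - w))\<^sup>2 / 4 \<le> (u - w) \<bullet> (- h k)"
    using comonotone_scaled[of "x (Suc k)" "x k" "- h k"]
    unfolding uw by (simp add: x_Suc)
  then have "2 * ((u - w) \<bullet> h k) \<le> (norm (u - w))\<^sup>2 / 2"
    by simp
  moreover have "residual (Suc k) = (norm (h k + u))\<^sup>2 + (norm u)\<^sup>2"
    and "residual k = (norm (h k + w))\<^sup>2 + (norm (w + v))\<^sup>2"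
    by (simp_all add: residual_def u_def v_def w_def)
  then have "residual (Suc k) - residual k
      = 2 * ((u - w) \<bullet> h k) + 2 * (norm u)\<^sup>2 - (norm w)\<^sup>2 - (norm (w + v))\<^sup>2"
    unfolding power2_norm_eq_inner
    by (simp add: inner_add_left inner_add_right inner_diff_left inner_diff_right inner_commute)
  ultimately have "residual (Suc k) - residual k
      \<le> 8/3 * (norm u)\<^sup>2 + 2/3 * (u \<bullet> v) - 1/3 * (norm v)\<^sup>2"
    using residual_form_le[of u w v] by linarith
  moreover have "u \<bullet> v \<le> (norm u)\<^sup>2 / 4"
    using comonotone_scaled[OF x_Suc_minus_xt[of k]]
    by (simp add: u_def v_def inner_diff_right)
  moreover have "(norm u)\<^sup>2 \<le> 100/961 * (norm v)\<^sup>2"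
    using gradient_error by (simp add: u_def v_def)
  moreover have "0 \<le> (norm v)\<^sup>2"
    by simp
  ultimately have "residual (Suc k) - residual k \<le> - (norm v)\<^sup>2 / 50"
    by linarith
  then show ?thesis
    by (simp add: v_def)
qed

lemma residual_le: "residual (Suc k) \<le> 2 * (norm (h k))\<^sup>2 + drift k / 3"
proof -
  define u where "u = F (x (Suc k)) - h k"
  have "(norm (h k + u))\<^sup>2 + (norm (h k - u))\<^sup>2 = 2 * (norm (h k))\<^sup>2 + 2 * (norm u)\<^sup>2"
    unfolding power2_norm_eq_inner
    by (simp add: inner_add_left inner_add_right inner_diff_left inner_diff_right)
  then have "(norm (h k + u))\<^sup>2 \<le> 2 * (norm (h k))\<^sup>2 + 2 * (norm u)\<^sup>2"
    by (smt (verit) zero_le_power2)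
  moreover have "residual (Suc k) = (norm (h k + u))\<^sup>2 + (norm u)\<^sup>2"
    by (simp add: residual_def u_def)
  moreover have "(norm u)\<^sup>2 \<le> 100/961 * drift k"
    using gradient_error by (simp add: u_def)
  moreover have "0 \<le> drift k"
    by simp
  ultimately show ?thesis
    by linarith
qed

text \<open>Young's inequality gives up a quarter of the gain $\gamma^2\|h_k\|^2$ to the drift. What
  remains is $\gamma(\frac34\gamma - 2\rho) \ge \frac34\gamma(\gamma - 3\rho)$, which is where the factor
  $\gamma - 3\rho$ of the rate comes from.\<close>

lemma distance_decrease:
  "(norm (x (Suc k) - xstar))\<^sup>2
     \<le> (norm (x k - xstar))\<^sup>2 - 3/4 * (\<gamma> * (\<gamma> - 3 * \<rho>)) * (norm (h k))\<^sup>2 + 4 * \<gamma>\<^sup>2 * drift k"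
proof -
  define v where "v = h k - p k"
  have "(norm (h k))\<^sup>2 / 4 + 4 * (norm v)\<^sup>2 - 2 * (h k \<bullet> v)
      = (norm ((1/2) *\<^sub>R h k - 2 *\<^sub>R v))\<^sup>2"
    unfolding power2_norm_eq_inner
    by (simp add: inner_diff_left inner_diff_right inner_commute)
  then have "2 * (h k \<bullet> v) \<le> (norm (h k))\<^sup>2 / 4 + 4 * (norm v)\<^sup>2"
    by (smt (verit) zero_le_power2)
  moreover have "h k \<bullet> p k = (norm (h k))\<^sup>2 - h k \<bullet> v"
    unfolding power2_norm_eq_inner by (simp add: v_def inner_diff_right)
  ultimately have "- 2 * (h k \<bullet> p k) \<le> 4 * drift k - 7/4 * (norm (h k))\<^sup>2"
    by (simp add: v_def)
  then have "\<gamma>\<^sup>2 * (- 2 * (h k \<bullet> p k)) \<le> \<gamma>\<^sup>2 * (4 * drift k - 7/4 * (norm (h k))\<^sup>2)"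
    by (rule mult_left_mono) simp
  moreover have "0 \<le> \<gamma> * \<rho> * (norm (h k))\<^sup>2"
    using \<gamma>\<^sub>1_pos \<rho>_nonneg by simp
  ultimately show ?thesis
    using distance_step[of k] by (simp add: algebra_simps power2_eq_square)
qed

text \<open>The weight $\frac83$ makes the decrease of the distance match the cost
  $2\gamma(\gamma-3\rho)\|h_k\|^2$ of increasing the weight of the residual by
  $\gamma(\gamma - 3\rho)$. In units of $\gamma^2$ times the drift, the two errors are then at most
  $\frac13 + \frac{32}3 = 11$, less than the gain $\frac{800}{50} = 16$.\<close>

definition last_iterate_potential :: "nat \<Rightarrow> real" where
  "last_iterate_potential k =
     (real k * \<gamma> * (\<gamma> - 3 * \<rho>) + 800 * \<gamma>\<^sup>2) * residual k + 8/3 * (norm (x k - xstar))\<^sup>2"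

lemma rate_bounds: "0 \<le> \<gamma> * (\<gamma> - 3 * \<rho>)" "\<gamma> * (\<gamma> - 3 * \<rho>) \<le> \<gamma>\<^sup>2"
  using step_lower \<gamma>\<^sub>1_pos \<rho>_nonneg by (simp_all add: power2_eq_square)

lemma last_iterate_potential_step: "last_iterate_potential (Suc k) \<le> last_iterate_potential k"
proof -
  define r where "r = \<gamma> * (\<gamma> - 3 * \<rho>)"
  define W where "W = real k * r + 800 * \<gamma>\<^sup>2"
  have r: "0 \<le> r" "r \<le> \<gamma>\<^sup>2"
    using rate_bounds by (simp_all add: r_def)
  have W: "800 * \<gamma>\<^sup>2 \<le> W"
    using r by (simp add: W_def)
  define R R' d H where "R = residual k" and "R' = residual (Suc k)"
    and "d = drift k" and "H = (norm (h k))\<^sup>2"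
  have "0 \<le> d"
    by (simp add: d_def)
  have "W * R' \<le> W * (R - d / 50)"
    using residual_decrease order_trans[OF _ W] unfolding R_def R'_def d_def
    by (intro mult_left_mono) auto
  then have "W * R' \<le> W * R - W * d / 50"
    by (simp add: right_diff_distrib)
  moreover have "800 * (\<gamma>\<^sup>2 * d) \<le> W * d"
    using mult_right_mono[OF W \<open>0 \<le> d\<close>] by simp
  moreover have "r * R' \<le> r * (2 * H + d / 3)"
    using residual_le r(1) unfolding R'_def d_def H_def by (rule mult_left_mono)
  then have "r * R' \<le> 2 * (r * H) + r * d / 3"
    by (simp add: distrib_left)
  moreover have "r * d \<le> \<gamma>\<^sup>2 * d"
    using r(2) \<open>0 \<le> d\<close> by (rule mult_right_mono)
  moreover have "(norm (x (Suc k) - xstar))\<^sup>2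
      \<le> (norm (x k - xstar))\<^sup>2 - 3/4 * (r * H) + 4 * (\<gamma>\<^sup>2 * d)"
    using distance_decrease[of k] by (simp add: r_def d_def H_def)
  moreover have "0 \<le> \<gamma>\<^sup>2 * d"
    using \<open>0 \<le> d\<close> by simp
  moreover have "last_iterate_potential (Suc k)
      = W * R' + r * R' + 8/3 * (norm (x (Suc k) - xstar))\<^sup>2"
    by (simp add: last_iterate_potential_def W_def r_def R'_def algebra_simps)
  moreover have "last_iterate_potential k = W * R + 8/3 * (norm (x k - xstar))\<^sup>2"
    by (simp add: last_iterate_potential_def W_def r_def R_def algebra_simps)
  ultimately show ?thesis
    by linarith
qed

lemma last_iterate_potential_start:
  "last_iterate_potential 0 \<le> 717 * (norm (x0 - xstar))\<^sup>2"
proof -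
  have "\<gamma>\<^sup>2 * (norm (F x0))\<^sup>2 \<le> \<gamma>\<^sup>2 * (L\<^sup>2 * (norm (x0 - xstar))\<^sup>2)"
    using start_residual by (rule mult_left_mono) simp
  also have "\<dots> = (L * \<gamma>)\<^sup>2 * (norm (x0 - xstar))\<^sup>2"
    by (simp add: power_mult_distrib)
  also have "\<dots> \<le> 100/961 * (norm (x0 - xstar))\<^sup>2"
    using L\<gamma>_sq_le by (rule mult_right_mono) simp
  finally have "1600 * (\<gamma>\<^sup>2 * (norm (F x0))\<^sup>2) \<le> 1600 * (100/961 * (norm (x0 - xstar))\<^sup>2)"
    by simp
  moreover have "last_iterate_potential 0
      = 1600 * (\<gamma>\<^sup>2 * (norm (F x0))\<^sup>2) + 8/3 * (norm (x0 - xstar))\<^sup>2"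
    by (simp add: last_iterate_potential_def residual_def x_0)
  moreover have "0 \<le> (norm (x0 - xstar))\<^sup>2"
    by simp
  ultimately show ?thesis
    by linarith
qed

lemma last_iterate_bound:
  "(norm (F (x N)))\<^sup>2
     \<le> 717 * (norm (x0 - xstar))\<^sup>2 / (real N * \<gamma> * (\<gamma> - 3 * \<rho>) + 800 * \<gamma>\<^sup>2)"
proof -
  define W where "W = real N * \<gamma> * (\<gamma> - 3 * \<rho>) + 800 * \<gamma>\<^sup>2"
  have "0 \<le> real N * (\<gamma> * (\<gamma> - 3 * \<rho>))"
    using rate_bounds(1) by simp
  then have "W > 0"
    using \<gamma>\<^sub>1_pos by (simp add: W_def add_nonneg_pos mult.assoc)
  have "W * (norm (F (x N)))\<^sup>2 \<le> W * residual N"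
    using \<open>W > 0\<close> by (simp add: residual_def)
  also have "\<dots> \<le> last_iterate_potential N"
    by (simp add: last_iterate_potential_def W_def)
  also have "\<dots> \<le> last_iterate_potential 0"
    by (rule lift_Suc_antimono_le[of last_iterate_potential])
      (simp_all add: last_iterate_potential_step)
  also have "\<dots> \<le> 717 * (norm (x0 - xstar))\<^sup>2"
    by (rule last_iterate_potential_start)
  finally show ?thesis
    unfolding W_def[symmetric] using \<open>W > 0\<close> by (simp add: pos_le_divide_eq mult.commute)
qed

end

section \<open>Convergence of the optimistic gradient method\<close>

theorem theorem4p4:
  fixes F :: "real ^ 'd \<Rightarrow> real ^ 'd"
    and L \<rho> :: real
    and xstar :: "real ^ 'd"
  assumes "L > 0"
    and "\<rho> \<ge> 0"
    and "L-lipschitz_on UNIV F"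
    and "star_negative_comonotone \<rho> F"
    and "\<rho> < 1 / (2 * L)"
    and "F xstar = 0"
  shows
    "(\<forall>\<gamma>\<^sub>1 \<gamma>\<^sub>2 x0 x xt.
        2 * \<rho> < \<gamma>\<^sub>1 \<and> \<gamma>\<^sub>1 < 1 / L \<and>
        0 < \<gamma>\<^sub>2 \<and> \<gamma>\<^sub>2 < min (1 / L - \<gamma>\<^sub>1) (\<gamma>\<^sub>1 - 2 * \<rho>) \<and>
        optimistic_gradient F \<gamma>\<^sub>1 \<gamma>\<^sub>2 x0 x xt \<longrightarrow>
        (\<forall>N::nat. 1 / (real N + 1) * (\<Sum>k=0..N. (norm (F (xt k)))\<^sup>2)
           \<le> (norm (x0 - xstar))\<^sup>2 /
              (\<gamma>\<^sub>1 * \<gamma>\<^sub>2 * (1 - L\<^sup>2 * (\<gamma>\<^sub>1 + \<gamma>\<^sub>2)\<^sup>2) * (real N + 1))))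
     \<and>
     (negative_comonotone \<rho> F \<and> \<rho> \<le> 5 / (62 * L) \<longrightarrow>
       (\<forall>\<gamma> x0 x xt.
          \<gamma> > 0 \<and> 4 * \<rho> \<le> \<gamma> \<and> \<gamma> \<le> 10 / (31 * L) \<and>
          optimistic_gradient F \<gamma> \<gamma> x0 x xt \<longrightarrow>
          (\<forall>N::nat. N \<ge> 1 \<longrightarrow>
             (norm (F (x N)))\<^sup>2
               \<le> 717 * (norm (x0 - xstar))\<^sup>2 /
                  (real N * \<gamma> * (\<gamma> - 3 * \<rho>) + 800 * \<gamma>\<^sup>2))))"
proof (intro conjI allI impI, goal_cases)
  case (1 \<gamma>\<^sub>1 \<gamma>\<^sub>2 x0 x xt N)
  then interpret optimistic_gradient_run F L \<rho> \<gamma>\<^sub>1 \<gamma>\<^sub>2 x0 xstar x xt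
    using assms by unfold_locales auto
  have "\<gamma>\<^sub>1 + \<gamma>\<^sub>2 < 1 / L"
    using 1 by simp
  then have "L * (\<gamma>\<^sub>1 + \<gamma>\<^sub>2) < 1"
    using \<open>L > 0\<close> by (simp add: pos_less_divide_eq mult.commute)
  then show ?case
    using 1 by (intro averaged_bound) auto
next
  case (2 \<gamma> x0 x xt N)
  have "L * \<gamma> \<le> 10/31"
    using 2 \<open>L > 0\<close> by (simp add: field_simps)
  then interpret equal_step_run F L \<rho> \<gamma> x0 xstar x xt
    using 2 assms by unfold_locales auto
  show ?case
    by (rule last_iterate_bound)
qed

end
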